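(* Consider the Riemann problem of the kinematic wave model of diverging traffic with one upstream link $0$ and two downstream links $1,2$, with initial states $U_0=(D_0,S_0)$ on link $0$ and $U_i=(D_i,S_i)$ on link $i$ ($i=1,2$). The boundary fluxes satisfying the entropy condition $$q_i=\min\left\{1,\ \frac{D_0(0^-,t)}{S_1(0^+,t)+S_2(0^+,t)}\right\}S_i(0^+,t),\quad i=1,2,$$ the traffic conservation equations, and the admissible conditions on stationary and interior states are the following. 1. When $S_1+S_2\le D_0$: $q_i=S_i$ ($i=1,2$) and $q_0=S_1+S_2$. 2. When $S_i>\frac{C_i}{C_1+C_2}D_0$ for $i=1,2$: $q_i=\frac{C_i}{C_1+C_2}D_0$ ($i=1,2$) and $q_0=D_0$. 3. When $S_1+S_2>D_0$ and $S_i\le\frac{C_i}{C_1+C_2}D_0$ (where $\{i,j\}=\{1,2\}$): $q_i=S_i$, $q_j=D_0-S_i$, and $q_0=D_0$. That is, $q_0=\min\{D_0,S_1+S_2\}$, and for $i,j\in\{1,2\}$ with $i\ne j$, $$q_i=\min\left\{S_i,\ \max\left\{D_0-S_j,\ \frac{D_0}{C_1+C_2}C_i\right\}\right\}.$$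
   Context: Network and model. A diverge has one upstream link $0$ (coordinate $x_0\in(-\infty,0)$) and two downstream links $1,2$ (coordinates $x_i\in(0,\infty)$), meeting at $x=0$. In this model vehicles have no predefined routes and belong to the same commodity. Each link $a$ is homogeneous with a unimodal flow-density relation $q=Q_a(\rho)=\rho V_a(\rho)$, critical density $\rho_{c,a}$, and capacity $C_a=Q_a(\rho_{c,a})>0$; traffic on link $a$ obeys $\partial_t\rho+\partial_x Q_a(\rho)=0$. The Riemann problem has constant initial density on each link. Supply-demand space. Demand and supply on link $a$ are $D(\rho)=Q_a(\min\{\rho,\rho_{c,a}\})$ and $S(\rho)=Q_a(\max\{\rho,\rho_{c,a}\})$. A traffic state on link $a$ is represented as a pair $U=(D,S)$ with $0\le D,S\le C_a$ and $\max\{D,S\}=C_a$; its flow-rate is $q(U)=\min\{D,S\}$. A state is under-critical (UC) if $S=C_a$, over-critical (OC) if $D=C_a$, strictly under-critical (SUC) if $D<S=C_a$, strictly over-critical (SOC) if $S<D=C_a$. The initial states are $U_0=(D_0,S_0)$ and $U_i=(D_i,S_i)$. Unknowns (for $t>0$): stationary states $U_0^-=(D_0^-,S_0^-)$ on link $0$ and $U_i^+=(D_i^+,S_i^+)$ on link $i$; interior states at the junction $U_0(0^-,t)=(D_0(0^-,t),S_0(0^-,t))$ (a state on link $0$) and $U_i(0^+,t)=(D_i(0^+,t),S_i(0^+,t))$ (a state on link $i$), $i=1,2$. Boundary fluxes and traffic conservation: $q_0=q(U_0^-)$, $q_i=q(U_i^+)$, $q_0=q_1+q_2$. Admissible conditions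 for stationary states: $U_0^-=(D_0,C_0)$, or $U_0^-=(C_0,S_0^-)$ with $S_0^-<D_0$; and $U_i^+=(C_i,S_i)$, or $U_i^+=(D_i^+,C_i)$ with $D_i^+<S_i$. Admissible conditions for interior states: if $U_0^-$ is SOC then $U_0(0^-,t)=U_0^-$; if $U_0^-$ is UC then $U_0(0^-,t)$ is any state on link $0$ with $S_0(0^-,t)\ge D_0^-$; if $U_i^+$ is SUC then $U_i(0^+,t)=U_i^+$; if $U_i^+$ is OC then $U_i(0^+,t)$ is any state on link $i$ with $D_i(0^+,t)\ge S_i^+$. Convention: in the entropy condition, $q_1=q_2=0$ if $S_1(0^+,t)=S_2(0^+,t)=0$. *)

theory Defs
  imports Complex_Main
begin

record link =
  speed :: "real \<Rightarrow> real"
  crit_density :: real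

definition flow_density :: "link \<Rightarrow> real \<Rightarrow> real" where
  "flow_density L \<rho> = \<rho> * speed L \<rho>"

definition capacity :: "link \<Rightarrow> real" where
  "capacity L = flow_density L (crit_density L)"

text \<open>Unimodality is meant in the weak sense. No jam density is fixed: a flow-density relation that
  is given up to a jam density only can be extended by zero.\<close>

definition traffic_link :: "link \<Rightarrow> bool" where
  "traffic_link L \<longleftrightarrow>
     0 < crit_density L \<and>
     mono_on {0..crit_density L} (flow_density L) \<and>
     antimono_on {crit_density L..} (flow_density L) \<and>
     0 < capacity L"

definition demand_at :: "link \<Rightarrow> real \<Rightarrow> real" where
  "demand_at L \<rho> = flow_density L (min \<rho> (crit_density L))"

definition supply_at :: "link \<Rightarrow> real \<Rightarrow> real" where
  "supply_at L \<rho> = flow_density L (max \<rho> (crit_density L))"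

text \<open>A state is a pair (demand, supply).\<close>

type_synonym state = "real \<times> real"

abbreviation dem :: "state \<Rightarrow> real" where "dem U \<equiv> fst U"
abbreviation spl :: "state \<Rightarrow> real" where "spl U \<equiv> snd U"

definition state_on :: "link \<Rightarrow> state \<Rightarrow> bool" where
  "state_on L U \<longleftrightarrow>
     0 \<le> dem U \<and> dem U \<le> capacity L \<and> 0 \<le> spl U \<and> spl U \<le> capacity L \<and>
     max (dem U) (spl U) = capacity L"

definition flow_rate :: "state \<Rightarrow> real" where
  "flow_rate U = min (dem U) (spl U)"

lemma state_on_demand_at_supply_at:
  assumes "traffic_link L" "0 \<le> \<rho>" "0 \<le> flow_density L \<rho>"
  shows "state_on L (demand_at L \<rho>, supply_at L \<rho>)"
    and "flow_rate (demand_at L \<rho>, supply_at L \<rho>) = flow_density L \<rho>"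
proof -
  have le: "flow_density L \<rho> \<le> capacity L"
  proof (cases "\<rho> \<le> crit_density L")
    case True
    then show ?thesis using assms unfolding traffic_link_def capacity_def
      by (auto dest: mono_onD[where r = \<rho> and s = "crit_density L"])
  next
    case False
    then show ?thesis using assms unfolding traffic_link_def capacity_def
      by (auto dest: monotone_onD[where x = "crit_density L" and y = \<rho>])
  qed
  show "state_on L (demand_at L \<rho>, supply_at L \<rho>)"
    and "flow_rate (demand_at L \<rho>, supply_at L \<rho>) = flow_density L \<rho>"
    using le assms
    by (auto simp: state_on_def flow_rate_def demand_at_def supply_at_def capacity_def traffic_link_def
        min_def max_def)
qed

definition UC :: "link \<Rightarrow> state \<Rightarrow> bool" where
  "UC L U \<longleftrightarrow> spl U = capacity L"

definition OC :: "link \<Rightarrow> state \<Rightarrow> bool" where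
  "OC L U \<longleftrightarrow> dem U = capacity L"

definition SUC :: "link \<Rightarrow> state \<Rightarrow> bool" where
  "SUC L U \<longleftrightarrow> dem U < spl U \<and> spl U = capacity L"

definition SOC :: "link \<Rightarrow> state \<Rightarrow> bool" where
  "SOC L U \<longleftrightarrow> spl U < dem U \<and> dem U = capacity L"

text \<open>In the following, \<open>U\<close> is the initial, \<open>Us\<close> the stationary and \<open>Ui\<close> the interior state.\<close>

definition stationary_upstream :: "link \<Rightarrow> state \<Rightarrow> state \<Rightarrow> bool" where
  "stationary_upstream L U Us \<longleftrightarrow> state_on L Us \<and>
     (Us = (dem U, capacity L) \<or> (\<exists>S. Us = (capacity L, S) \<and> S < dem U))"

definition stationary_downstream :: "link \<Rightarrow> state \<Rightarrow> state \<Rightarrow> bool" where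
  "stationary_downstream L U Us \<longleftrightarrow> state_on L Us \<and>
     (Us = (capacity L, spl U) \<or> (\<exists>D. Us = (D, capacity L) \<and> D < spl U))"

definition interior_upstream :: "link \<Rightarrow> state \<Rightarrow> state \<Rightarrow> bool" where
  "interior_upstream L Us Ui \<longleftrightarrow> state_on L Ui \<and>
     (SOC L Us \<longrightarrow> Ui = Us) \<and> (UC L Us \<longrightarrow> dem Us \<le> spl Ui)"

definition interior_downstream :: "link \<Rightarrow> state \<Rightarrow> state \<Rightarrow> bool" where
  "interior_downstream L Us Ui \<longleftrightarrow> state_on L Ui \<and>
     (SUC L Us \<longrightarrow> Ui = Us) \<and> (OC L Us \<longrightarrow> spl Us \<le> dem Ui)"

text \<open>Links and everything attached to them are indexed by 0 (upstream), 1 and 2 (downstream).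
  Values at other indices are irrelevant.\<close>

definition entropy_condition :: "(nat \<Rightarrow> state) \<Rightarrow> (nat \<Rightarrow> real) \<Rightarrow> bool" where
  "entropy_condition Ui q \<longleftrightarrow> (\<forall>i\<in>{1,2}.
     q i = (if spl (Ui 1) = 0 \<and> spl (Ui 2) = 0 then 0
            else min 1 (dem (Ui 0) / (spl (Ui 1) + spl (Ui 2))) * spl (Ui i)))"

definition boundary_fluxes :: "(nat \<Rightarrow> link) \<Rightarrow> (nat \<Rightarrow> state) \<Rightarrow> (nat \<Rightarrow> real) \<Rightarrow> bool" where
  "boundary_fluxes L U q \<longleftrightarrow> (\<exists>(Us :: nat \<Rightarrow> state) (Ui :: nat \<Rightarrow> real \<Rightarrow> state).
     (\<forall>a\<in>{0,1,2}. q a = flow_rate (Us a)) \<and>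
     q 0 = q 1 + q 2 \<and>
     stationary_upstream (L 0) (U 0) (Us 0) \<and>
     (\<forall>i\<in>{1,2}. stationary_downstream (L i) (U i) (Us i)) \<and>
     (\<forall>t>0. interior_upstream (L 0) (Us 0) (Ui 0 t) \<and>
            (\<forall>i\<in>{1,2}. interior_downstream (L i) (Us i) (Ui i t)) \<and>
            entropy_condition (\<lambda>a. Ui a t) q))"

end

theory Submission
  imports Defs
begin

text \<open>
  A link either carries its desired flow (the initial demand upstream, the initial supply
  downstream), in which case the interior state leaves the quantity that the junction sees free, or it carries strictly less,
  in which case the interior state equals the stationary state and offers the full capacity to the
  junction. Exchanging demand and supply turns the downstream conditions into the upstream ones, so
  a single relation \<open>admissible\<close> between real numbers describes all three links
  (\<open>boundary_fluxes_iff\<close>).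

  Uniqueness: the entropy condition distributes \<open>min {d, \<sigma>\<^sub>1 + \<sigma>\<^sub>2}\<close>
  in proportion to the interior supplies \<open>\<sigma>\<^sub>i\<close>, where \<open>d\<close> is the interior demand.
  If the upstream link carries less than \<open>D\<^sub>0\<close>, the demand \<open>d\<close> is \<open>C\<^sub>0\<close> and does not bind, so
  \<open>q\<^sub>i = \<sigma>\<^sub>i\<close>, which is incompatible with \<open>q\<^sub>i < S\<^sub>i\<close>
  and \<open>\<sigma>\<^sub>i = C\<^sub>i\<close>. Hence \<open>q\<^sub>0 = min {D\<^sub>0, S\<^sub>1 + S\<^sub>2}\<close>.
  If link \<open>i\<close> carries less than \<open>S\<^sub>i\<close>, it enters the distribution with its full capacity
  while the other link enters with at most its capacity, so
  link \<open>i\<close> receives at least its capacity share \<open>C\<^sub>i D\<^sub>0 / (C\<^sub>1 + C\<^sub>2)\<close>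
  (\<open>capacity_share_le_flux\<close>). These two facts are linear and determine the fluxes.

  Existence: call a downstream link saturated if it carries its initial supply. If both are
  saturated, the interior supplies are the initial ones; if neither is
  saturated, they are the capacities; and if only link \<open>1\<close> is saturated, then
  \<open>\<sigma>\<^sub>2 = C\<^sub>2\<close> and \<open>\<sigma>\<^sub>1\<close> is the number for which the proportional
  distribution of \<open>D\<^sub>0\<close> gives link \<open>1\<close> exactly \<open>S\<^sub>1\<close>.
\<close>

section \<open>Admissible states of a single link\<close>

text \<open>
  Here \<open>C\<close> is the capacity, \<open>b\<close> the initial demand (upstream) or supply (downstream), \<open>f\<close> the
  boundary flux, and \<open>v\<close> the demand or supply that the interior state offers to the junction.
\<close>

definition admissible :: "real \<Rightarrow> real \<Rightarrow> real \<Rightarrow> real \<Rightarrow> bool" where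
  "admissible C b f v \<longleftrightarrow> 0 \<le> f \<and> f \<le> b \<and> 0 \<le> v \<and> v \<le> C \<and> (f < b \<longrightarrow> v = C)"

lemma admissible_upstreamI:
  assumes "state_on L U" "stationary_upstream L U Us" "interior_upstream L Us V"
  shows "admissible (capacity L) (dem U) (flow_rate Us) (dem V)"
  using assms
  by (auto simp: admissible_def state_on_def stationary_upstream_def interior_upstream_def
      flow_rate_def SOC_def UC_def)

lemma admissible_upstreamE:
  assumes "state_on L U" "admissible (capacity L) (dem U) f d"
  obtains Us V where "stationary_upstream L U Us" "flow_rate Us = f"
    "interior_upstream L Us V" "dem V = d"
proof (cases "f < dem U")
  case True
  \<comment> \<open>The stationary state is strictly over-critical and equal to the interior state.\<close>
  show ?thesis
    by (rule that[of "(capacity L, f)" "(capacity L, f)"])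
      (use True assms in \<open>auto simp: admissible_def state_on_def stationary_upstream_def
          interior_upstream_def flow_rate_def SOC_def UC_def\<close>)
next
  case False
  show ?thesis
    by (rule that[of "(dem U, capacity L)" "(d, capacity L)"])
      (use False assms in \<open>auto simp: admissible_def state_on_def stationary_upstream_def
          interior_upstream_def flow_rate_def SOC_def UC_def\<close>)
qed

text \<open>Exchanging demand and supply mirrors a downstream link into an upstream one.\<close>

lemma state_on_swap: "state_on L (prod.swap U) \<longleftrightarrow> state_on L U"
  by (auto simp: state_on_def max.commute)

lemma flow_rate_swap: "flow_rate (prod.swap U) = flow_rate U"
  by (simp add: flow_rate_def min.commute)

lemma stationary_downstream_eq_upstream_swap:
  "stationary_downstream L U Us \<longleftrightarrow> stationary_upstream L (prod.swap U) (prod.swap Us)"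
  unfolding stationary_downstream_def stationary_upstream_def state_on_swap
  by (cases Us) auto

lemma interior_downstream_eq_upstream_swap:
  "interior_downstream L Us V \<longleftrightarrow> interior_upstream L (prod.swap Us) (prod.swap V)"
  unfolding interior_downstream_def interior_upstream_def state_on_swap
  by (cases Us; cases V) (auto simp: SUC_def SOC_def OC_def UC_def)

lemma admissible_downstreamI:
  assumes "state_on L U" "stationary_downstream L U Us" "interior_downstream L Us V"
  shows "admissible (capacity L) (spl U) (flow_rate Us) (spl V)"
  using admissible_upstreamI[of L "prod.swap U" "prod.swap Us" "prod.swap V"] assms
  by (simp add: state_on_swap flow_rate_swap stationary_downstream_eq_upstream_swap
      interior_downstream_eq_upstream_swap)

lemma admissible_downstreamE:
  assumes "state_on L U" "admissible (capacity L) (spl U) f s"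
  obtains Us V where "stationary_downstream L U Us" "flow_rate Us = f"
    "interior_downstream L Us V" "spl V = s"
proof -
  obtain Us V where "stationary_upstream L (prod.swap U) Us" "flow_rate Us = f"
      "interior_upstream L Us V" "dem V = s"
  proof (rule admissible_upstreamE)
    show "state_on L (prod.swap U)" "admissible (capacity L) (dem (prod.swap U)) f s"
      using assms by (simp_all add: state_on_swap)
  qed
  then show ?thesis
    using that[of "prod.swap Us" "prod.swap V"]
    by (simp add: flow_rate_swap stationary_downstream_eq_upstream_swap
        interior_downstream_eq_upstream_swap)
qed

section \<open>Reduction to real numbers\<close>

text \<open>
  If both interior supplies vanish, the general formula is a multiple of zero whatever value the
  quotient has, so it already contains the convention.
\<close>

lemma entropy_condition_iff:
  "entropy_condition V q \<longleftrightarrow>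
     q 1 = min 1 (dem (V 0) / (spl (V 1) + spl (V 2))) * spl (V 1) \<and>
     q 2 = min 1 (dem (V 0) / (spl (V 1) + spl (V 2))) * spl (V 2)"
  by (auto simp: entropy_condition_def)

definition junction_solution ::
    "real \<Rightarrow> real \<Rightarrow> real \<Rightarrow> real \<Rightarrow> real \<Rightarrow> real \<Rightarrow> real \<Rightarrow> real \<Rightarrow> bool" where
  "junction_solution C0 C1 C2 D s1 s2 q1 q2 \<longleftrightarrow> (\<exists>d \<sigma>1 \<sigma>2.
     admissible C0 D (q1 + q2) d \<and> admissible C1 s1 q1 \<sigma>1 \<and> admissible C2 s2 q2 \<sigma>2 \<and>
     q1 = min 1 (d / (\<sigma>1 + \<sigma>2)) * \<sigma>1 \<and> q2 = min 1 (d / (\<sigma>1 + \<sigma>2)) * \<sigma>2)"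

lemma junction_solution_commute:
  "junction_solution C0 C1 C2 D s1 s2 q1 q2 \<longleftrightarrow> junction_solution C0 C2 C1 D s2 s1 q2 q1"
  unfolding junction_solution_def by (metis add.commute)

lemma boundary_fluxes_iff:
  assumes st: "\<forall>a\<in>{0,1,2}. state_on (L a) (U a)"
  shows "boundary_fluxes L U q \<longleftrightarrow> q 0 = q 1 + q 2 \<and>
    junction_solution (capacity (L 0)) (capacity (L 1)) (capacity (L 2))
      (dem (U 0)) (spl (U 1)) (spl (U 2)) (q 1) (q 2)"
    (is "?B \<longleftrightarrow> ?sum \<and> ?J")
proof
  assume ?B
  then obtain Us and V :: "nat \<Rightarrow> real \<Rightarrow> state" where
    q: "\<forall>a\<in>{0,1,2}. q a = flow_rate (Us a)" and sum: ?sum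
    and s: "stationary_upstream (L 0) (U 0) (Us 0)"
      "\<forall>i\<in>{1,2}. stationary_downstream (L i) (U i) (Us i)"
    and v: "\<forall>t>0. interior_upstream (L 0) (Us 0) (V 0 t) \<and>
            (\<forall>i\<in>{1,2}. interior_downstream (L i) (Us i) (V i t)) \<and>
            entropy_condition (\<lambda>a. V a t) q"
    unfolding boundary_fluxes_def by blast
  from v have v: "interior_upstream (L 0) (Us 0) (V 0 1)"
      "\<forall>i\<in>{1,2}. interior_downstream (L i) (Us i) (V i 1)"
      "entropy_condition (\<lambda>a. V a 1) q"
    by auto
  have "admissible (capacity (L 0)) (dem (U 0)) (q 1 + q 2) (dem (V 0 1))"
    using admissible_upstreamI[OF _ s(1) v(1)] st q unfolding sum[symmetric] by simp
  moreover have "admissible (capacity (L i)) (spl (U i)) (q i) (spl (V i 1))"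
    if "i \<in> {1,2}" for i
    using admissible_downstreamI[of "L i" "U i" "Us i" "V i 1"] that st q s v by auto
  ultimately show "?sum \<and> ?J"
    using v(3) sum unfolding junction_solution_def entropy_condition_iff by blast
next
  assume "?sum \<and> ?J"
  then obtain d \<sigma>1 \<sigma>2 where sum: ?sum and
    a: "admissible (capacity (L 0)) (dem (U 0)) (q 0) d"
      "admissible (capacity (L 1)) (spl (U 1)) (q 1) \<sigma>1"
      "admissible (capacity (L 2)) (spl (U 2)) (q 2) \<sigma>2"
    and e: "q 1 = min 1 (d / (\<sigma>1 + \<sigma>2)) * \<sigma>1" "q 2 = min 1 (d / (\<sigma>1 + \<sigma>2)) * \<sigma>2"
    unfolding junction_solution_def by metis
  have st': "state_on (L 0) (U 0)" "state_on (L 1) (U 1)" "state_on (L 2) (U 2)"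
    using st by auto
  obtain Us0 V0 where 0: "stationary_upstream (L 0) (U 0) Us0" "flow_rate Us0 = q 0"
    "interior_upstream (L 0) Us0 V0" "dem V0 = d"
    using admissible_upstreamE[OF st'(1) a(1)] by blast
  obtain Us1 V1 where 1: "stationary_downstream (L 1) (U 1) Us1" "flow_rate Us1 = q 1"
    "interior_downstream (L 1) Us1 V1" "spl V1 = \<sigma>1"
    using admissible_downstreamE[OF st'(2) a(2)] by blast
  obtain Us2 V2 where 2: "stationary_downstream (L 2) (U 2) Us2" "flow_rate Us2 = q 2"
    "interior_downstream (L 2) Us2 V2" "spl V2 = \<sigma>2"
    using admissible_downstreamE[OF st'(3) a(3)] by blast
  define Us where "Us = (\<lambda>a::nat. if a = 0 then Us0 else if a = 1 then Us1 else Us2)"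
  define V where "V = (\<lambda>(a::nat) (t::real). if a = 0 then V0 else if a = 1 then V1 else V2)"
  show ?B
    unfolding boundary_fluxes_def
    by (rule exI[of _ Us], rule exI[of _ V])
      (use 0 1 2 sum e in \<open>simp add: Us_def V_def entropy_condition_iff\<close>)
qed

section \<open>Uniqueness of the fluxes\<close>

lemma capacity_shares_sum:
  fixes C1 C2 D :: real
  assumes "0 < C1" "0 < C2"
  shows "D / (C1 + C2) * C1 + D / (C1 + C2) * C2 = D"
proof -
  have "D / (C1 + C2) * C1 + D / (C1 + C2) * C2 = D / (C1 + C2) * (C1 + C2)"
    by (simp only: distrib_left)
  then show ?thesis using assms by simp
qed

lemma proportional_total:
  fixes d s :: real
  assumes "0 \<le> d" "0 \<le> s"
  shows "min 1 (d / s) * s = min s d"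
  using assms by (cases "s = 0") (auto simp: min_def field_simps)

text \<open>
  If the total flux is below \<open>D\<close>, the interior demand is \<open>C0 \<ge> D\<close> and does not bind, so each
  downstream link takes its whole interior supply. A downstream flux below the initial supply would
  then equal the capacity of its link, which is at least that supply.
\<close>

lemma total_flux_eq:
  assumes J: "junction_solution C0 C1 C2 D s1 s2 q1 q2"
    and "D \<le> C0" "s1 \<le> C1" "s2 \<le> C2"
  shows "q1 + q2 = min D (s1 + s2)"
proof -
  obtain d \<sigma>1 \<sigma>2 where
    a: "admissible C0 D (q1 + q2) d" "admissible C1 s1 q1 \<sigma>1" "admissible C2 s2 q2 \<sigma>2"
    and e: "q1 = min 1 (d / (\<sigma>1 + \<sigma>2)) * \<sigma>1" "q2 = min 1 (d / (\<sigma>1 + \<sigma>2)) * \<sigma>2"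
    using J unfolding junction_solution_def by blast
  have nonneg: "0 \<le> d" "0 \<le> \<sigma>1" "0 \<le> \<sigma>2"
    using a unfolding admissible_def by blast+
  then have total: "q1 + q2 = min (\<sigma>1 + \<sigma>2) d"
    using proportional_total[of d "\<sigma>1 + \<sigma>2"] e by (metis add_nonneg_nonneg distrib_left)
  have "q1 \<le> \<sigma>1" "q2 \<le> \<sigma>2"
    unfolding e by (rule mult_left_le_one_le; use nonneg in simp)+
  then show ?thesis
    using a total assms unfolding admissible_def min_def by (smt (verit))
qed

text \<open>
  A link that carries less than its supply enters the proportional distribution with its full
  capacity, whereas the interior supply of the other link is at most the capacity of that other link.
\<close>

lemma capacity_share_le_flux:
  assumes J: "junction_solution C0 C1 C2 D s1 s2 q1 q2"
    and "0 < C1" "0 < C2" "q1 < s1" "q1 + q2 = D"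
  shows "D / (C1 + C2) * C1 \<le> q1"
proof -
  obtain d \<sigma>1 \<sigma>2 where
    a: "admissible C1 s1 q1 \<sigma>1" "admissible C2 s2 q2 \<sigma>2"
    and e: "q1 = min 1 (d / (\<sigma>1 + \<sigma>2)) * \<sigma>1" "q2 = min 1 (d / (\<sigma>1 + \<sigma>2)) * \<sigma>2"
    using J unfolding junction_solution_def by blast
  have "\<sigma>1 = C1" "\<sigma>2 \<le> C2" "0 \<le> q1"
    using a assms unfolding admissible_def by auto
  moreover have "q2 * \<sigma>1 = q1 * \<sigma>2"
    by (subst e(1), subst e(2)) (simp add: mult.commute mult.left_commute)
  ultimately have "q2 * C1 \<le> q1 * C2"
    by (simp add: mult_left_mono)
  then have "D * C1 \<le> q1 * (C1 + C2)"
    using \<open>q1 + q2 = D\<close> by (auto simp: algebra_simps)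
  then show ?thesis
    using assms by (simp add: pos_divide_le_eq)
qed

section \<open>Existence of a solution\<close>

lemma junction_solution_uncongested:
  assumes "0 \<le> s1" "s1 \<le> C1" "0 \<le> s2" "s2 \<le> C2" "s1 + s2 \<le> D" "D \<le> C0"
  shows "junction_solution C0 C1 C2 D s1 s2 s1 s2"
proof -
  have "s1 = min 1 (C0 / (s1 + s2)) * s1 \<and> s2 = min 1 (C0 / (s1 + s2)) * s2"
  proof (cases "s1 + s2 = 0")
    case False
    then have "1 \<le> C0 / (s1 + s2)"
      using assms by (simp add: le_divide_eq)
    then show ?thesis
      by (simp add: min_absorb1)
  qed (use assms in auto)
  then show ?thesis
    using assms unfolding junction_solution_def
    by (intro exI[of _ C0] exI[of _ s1] exI[of _ s2]) (auto simp: admissible_def)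
qed

lemma junction_solution_capacity_shares:
  assumes "0 < C1" "0 < C2" "0 \<le> D" "D \<le> C0" "s1 \<le> C1" "s2 \<le> C2"
    and "D / (C1 + C2) * C1 < s1" "D / (C1 + C2) * C2 < s2"
  shows "junction_solution C0 C1 C2 D s1 s2 (D / (C1 + C2) * C1) (D / (C1 + C2) * C2)"
proof -
  have "D / (C1 + C2) * C1 < 1 * C1"
    using assms by simp
  then have "D / (C1 + C2) < 1"
    using \<open>0 < C1\<close> by (simp only: mult_less_cancel_right_pos)
  moreover have "D / (C1 + C2) * C1 + D / (C1 + C2) * C2 = D"
    using assms(1,2) by (rule capacity_shares_sum)
  ultimately show ?thesis
    using assms unfolding junction_solution_def
    by (intro exI[of _ D] exI[of _ C1] exI[of _ C2]) (auto simp: admissible_def)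
qed

text \<open>
  The interior supply \<open>\<sigma>\<close> of the saturated link solves \<open>s1 * (\<sigma> + C2) = D * \<sigma>\<close>. It is at most
  \<open>C1\<close> because \<open>s1\<close> is at most the capacity share, and the factor \<open>D / (\<sigma> + C2)\<close> is at most 1 because
  the other link can take the remaining flux \<open>D - s1\<close>.
\<close>

lemma junction_solution_one_saturated:
  assumes "0 < C1" "0 < C2" "0 \<le> D" "D \<le> C0" "0 \<le> s1" "s2 \<le> C2"
    and "D < s1 + s2" "s1 \<le> D / (C1 + C2) * C1"
  shows "junction_solution C0 C1 C2 D s1 s2 s1 (D - s1)"
proof -
  define \<sigma> where "\<sigma> = s1 * C2 / (D - s1)"
  have share: "s1 * (C1 + C2) \<le> D * C1"
    using assms by (simp add: pos_le_divide_eq)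
  have "s1 < D \<or> s1 = 0 \<and> D = 0"
  proof (cases "D = 0")
    case True
    then show ?thesis using assms by auto
  next
    case False
    have "D * C1 < D * (C1 + C2)" using False assms by simp
    then have "s1 * (C1 + C2) < D * (C1 + C2)" using share by simp
    then show ?thesis using assms by simp
  qed
  then consider "s1 < D" | "s1 = 0" "D = 0" by blast
  then show ?thesis
  proof cases
    case 1
    have \<sigma>: "0 \<le> \<sigma>" "\<sigma> \<le> C1" "\<sigma> + C2 = C2 * D / (D - s1)"
      using 1 assms share by (auto simp: \<sigma>_def field_simps)
    have "D - s1 \<le> C2" using assms by simp
    then have ratio: "D / (\<sigma> + C2) = (D - s1) / C2" "(D - s1) / C2 \<le> 1"
      using 1 assms \<sigma>(3) by auto
    have e: "s1 = min 1 (D / (\<sigma> + C2)) * \<sigma>" "D - s1 = min 1 (D / (\<sigma> + C2)) * C2"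
      unfolding ratio(1) using 1 assms ratio(2) by (simp_all add: \<sigma>_def min_absorb2)
    show ?thesis
      unfolding junction_solution_def
      by (intro exI[of _ D] exI[of _ \<sigma>] exI[of _ C2] conjI e)
        (use 1 assms \<sigma> in \<open>auto simp: admissible_def\<close>)
  next
    case 2
    then show ?thesis
      using assms unfolding junction_solution_def
      by (intro exI[of _ 0] exI[of _ C2]) (auto simp: admissible_def)
  qed
qed

section \<open>The boundary fluxes\<close>

lemma junction_solution_iff:
  fixes C0 C1 C2 D s1 s2 q1 q2 :: real
  assumes C: "0 < C1" "0 < C2"
    and D: "0 \<le> D" "D \<le> C0" and s: "0 \<le> s1" "s1 \<le> C1" "0 \<le> s2" "s2 \<le> C2"
  shows "junction_solution C0 C1 C2 D s1 s2 q1 q2 \<longleftrightarrow>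
    q1 = min s1 (max (D - s2) (D / (C1 + C2) * C1)) \<and>
    q2 = min s2 (max (D - s1) (D / (C1 + C2) * C2))"
    (is "?J q1 q2 \<longleftrightarrow> q1 = ?f1 \<and> q2 = ?f2")
proof -
  define p1 where "p1 = D / (C1 + C2) * C1"
  define p2 where "p2 = D / (C1 + C2) * C2"
  have p: "p1 + p2 = D"
    unfolding p1_def p2_def by (rule capacity_shares_sum[OF C])
  have f: "?f1 = min s1 (max (D - s2) p1)" "?f2 = min s2 (max (D - s1) p2)"
    by (simp_all add: p1_def p2_def)
  show ?thesis
  proof
    assume J: "?J q1 q2"
    have le: "q1 \<le> s1" "q2 \<le> s2"
      using J by (auto simp: junction_solution_def admissible_def)
    have total: "q1 + q2 = min D (s1 + s2)"
      using total_flux_eq[OF J] D s by simp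
    have "p1 \<le> q1" if "q1 < s1" "q1 + q2 = D"
      using capacity_share_le_flux[OF J] C that by (simp add: p1_def)
    moreover have "p2 \<le> q2" if "q2 < s2" "q1 + q2 = D"
      using capacity_share_le_flux[of C0 C2 C1 D s2 s1 q2 q1] J C that
      by (simp add: p2_def add.commute junction_solution_commute[of C0 C1])
    ultimately show "q1 = ?f1 \<and> q2 = ?f2"
      using le total p unfolding f unfolding min_def max_def by (smt (verit))
  next
    assume "q1 = ?f1 \<and> q2 = ?f2"
    then have q: "q1 = min s1 (max (D - s2) p1)" "q2 = min s2 (max (D - s1) p2)"
      unfolding f by simp_all
    consider "s1 + s2 \<le> D" | "p1 < s1" "p2 < s2"
      | "D < s1 + s2" "s1 \<le> p1" | "D < s1 + s2" "s2 \<le> p2"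
      by linarith
    then show "?J q1 q2"
    proof cases
      case 1
      then have "q1 = s1" "q2 = s2" using q by auto
      then show ?thesis using junction_solution_uncongested 1 D s by simp
    next
      case 2
      then have "q1 = p1" "q2 = p2" using q p by auto
      then show ?thesis
        using junction_solution_capacity_shares[of C1 C2 D C0 s1 s2] 2 C D s
        by (simp add: p1_def p2_def)
    next
      case 3
      then have "q1 = s1" "q2 = D - s1" using q p by auto
      then show ?thesis
        using junction_solution_one_saturated[of C1 C2 D C0 s1 s2] 3 C D s
        by (simp add: p1_def)
    next
      case 4
      then have "q2 = s2" "q1 = D - s2" using q p by auto
      then have "junction_solution C0 C2 C1 D s2 s1 q2 q1"
        using junction_solution_one_saturated[of C2 C1 D C0 s2 s1] 4 C D s
        by (simp add: p2_def add.commute)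
      then show ?thesis by (simp add: junction_solution_commute[of C0 C1])
    qed
  qed
qed

theorem corollary5p2:
  fixes L :: "nat \<Rightarrow> link" and U :: "nat \<Rightarrow> state" and q :: "nat \<Rightarrow> real"
  assumes "\<forall>a\<in>{0,1,2}. traffic_link (L a)"
    and "\<forall>a\<in>{0,1,2}. state_on (L a) (U a)"
  shows
    "(spl (U 1) + spl (U 2) \<le> dem (U 0) \<longrightarrow>
       (boundary_fluxes L U q \<longleftrightarrow>
          (\<forall>i\<in>{1,2}. q i = spl (U i)) \<and> q 0 = spl (U 1) + spl (U 2))) \<and>
     ((\<forall>i\<in>{1,2}. spl (U i) > capacity (L i) / (capacity (L 1) + capacity (L 2)) * dem (U 0)) \<longrightarrow>
       (boundary_fluxes L U q \<longleftrightarrow>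
          (\<forall>i\<in>{1,2}. q i = capacity (L i) / (capacity (L 1) + capacity (L 2)) * dem (U 0)) \<and>
          q 0 = dem (U 0))) \<and>
     (\<forall>i j. {i, j} = {1, 2} \<and> spl (U 1) + spl (U 2) > dem (U 0) \<and>
         spl (U i) \<le> capacity (L i) / (capacity (L 1) + capacity (L 2)) * dem (U 0) \<longrightarrow>
       (boundary_fluxes L U q \<longleftrightarrow>
          q i = spl (U i) \<and> q j = dem (U 0) - spl (U i) \<and> q 0 = dem (U 0))) \<and>
     (boundary_fluxes L U q \<longleftrightarrow>
        q 0 = min (dem (U 0)) (spl (U 1) + spl (U 2)) \<and>
        (\<forall>i\<in>{1,2}. \<forall>j\<in>{1,2}. i \<noteq> j \<longrightarrow>
           q i = min (spl (U i))
                     (max (dem (U 0) - spl (U j))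
                          (dem (U 0) / (capacity (L 1) + capacity (L 2)) * capacity (L i)))))"
proof -
  define D s1 s2 where "D = dem (U 0)" and "s1 = spl (U 1)" and "s2 = spl (U 2)"
  define C1 C2 where "C1 = capacity (L 1)" and "C2 = capacity (L 2)"
  define p1 p2 where "p1 = D / (C1 + C2) * C1" and "p2 = D / (C1 + C2) * C2"
  note defs = D_def s1_def s2_def C1_def C2_def
  have C: "0 < C1" "0 < C2"
    using assms(1) by (auto simp: traffic_link_def defs)
  have st: "0 \<le> D" "D \<le> capacity (L 0)" "0 \<le> s1" "s1 \<le> C1" "0 \<le> s2" "s2 \<le> C2"
    using assms(2) by (auto simp: state_on_def defs)
  have p: "p1 + p2 = D"
    unfolding p1_def p2_def by (rule capacity_shares_sum[OF C])
  have share: "C1 / (C1 + C2) * D = p1" "C2 / (C1 + C2) * D = p2"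
    by (simp_all add: p1_def p2_def)
  have main: "boundary_fluxes L U q \<longleftrightarrow> q 0 = q 1 + q 2 \<and>
      q 1 = min s1 (max (D - s2) p1) \<and> q 2 = min s2 (max (D - s1) p2)"
    unfolding boundary_fluxes_iff[OF assms(2)] defs[symmetric] p1_def p2_def
    using junction_solution_iff[OF C st] by simp
  have total: "min s1 (max (D - s2) p1) + min s2 (max (D - s1) p2) = min D (s1 + s2)"
    using p by (auto simp: min_def max_def)
  have index: "{i, j} = {1, 2::nat} \<longleftrightarrow> i = 1 \<and> j = 2 \<or> i = 2 \<and> j = 1" for i j
    by (auto simp: doubleton_eq_iff)
  have c1: "boundary_fluxes L U q \<longleftrightarrow> q 1 = s1 \<and> q 2 = s2 \<and> q 0 = s1 + s2"
    if "s1 + s2 \<le> D"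
    unfolding main using that by auto
  have c2: "boundary_fluxes L U q \<longleftrightarrow> q 1 = p1 \<and> q 2 = p2 \<and> q 0 = D"
    if "p1 < s1" "p2 < s2"
  proof -
    have "min s1 (max (D - s2) p1) = p1" "min s2 (max (D - s1) p2) = p2"
      using that p by auto
    then show ?thesis unfolding main using p by auto
  qed
  have c3: "boundary_fluxes L U q \<longleftrightarrow> q 1 = s1 \<and> q 2 = D - s1 \<and> q 0 = D"
    if "D < s1 + s2" "s1 \<le> p1"
  proof -
    have "min s1 (max (D - s2) p1) = s1" "min s2 (max (D - s1) p2) = D - s1"
      using that p by auto
    then show ?thesis unfolding main by auto
  qed
  have c4: "boundary_fluxes L U q \<longleftrightarrow> q 2 = s2 \<and> q 1 = D - s2 \<and> q 0 = D"
    if "D < s1 + s2" "s2 \<le> p2"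
  proof -
    have "min s1 (max (D - s2) p1) = D - s2" "min s2 (max (D - s1) p2) = s2"
      using that p by auto
    then show ?thesis unfolding main by auto
  qed
  have c5: "boundary_fluxes L U q \<longleftrightarrow> q 0 = min D (s1 + s2) \<and>
      q 1 = min s1 (max (D - s2) p1) \<and> q 2 = min s2 (max (D - s1) p2)"
    unfolding main using total by auto
  show ?thesis
  proof (intro conjI)
    show "spl (U 1) + spl (U 2) \<le> dem (U 0) \<longrightarrow>
       (boundary_fluxes L U q \<longleftrightarrow>
          (\<forall>i\<in>{1,2}. q i = spl (U i)) \<and> q 0 = spl (U 1) + spl (U 2))"
      using c1 by (simp add: defs)
    show "(\<forall>i\<in>{1,2}. spl (U i) > capacity (L i) / (capacity (L 1) + capacity (L 2)) * dem (U 0)) \<longrightarrow>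
       (boundary_fluxes L U q \<longleftrightarrow>
          (\<forall>i\<in>{1,2}. q i = capacity (L i) / (capacity (L 1) + capacity (L 2)) * dem (U 0)) \<and>
          q 0 = dem (U 0))"
      using c2[folded share, unfolded defs] by simp
    show "\<forall>i j. {i, j} = {1, 2} \<and> spl (U 1) + spl (U 2) > dem (U 0) \<and>
         spl (U i) \<le> capacity (L i) / (capacity (L 1) + capacity (L 2)) * dem (U 0) \<longrightarrow>
       (boundary_fluxes L U q \<longleftrightarrow>
          q i = spl (U i) \<and> q j = dem (U 0) - spl (U i) \<and> q 0 = dem (U 0))"
      using c3[folded share, unfolded defs] c4[folded share, unfolded defs] unfolding index by blast
    show "boundary_fluxes L U q \<longleftrightarrow>
        q 0 = min (dem (U 0)) (spl (U 1) + spl (U 2)) \<and>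
        (\<forall>i\<in>{1,2}. \<forall>j\<in>{1,2}. i \<noteq> j \<longrightarrow>
           q i = min (spl (U i))
                     (max (dem (U 0) - spl (U j))
                          (dem (U 0) / (capacity (L 1) + capacity (L 2)) * capacity (L i))))"
      using c5 by (simp add: p1_def p2_def defs)
  qed
qed

end
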